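(* Let $\mathcal{F}$ be an invertible iterated function system on a compact metric space $\mathbb{X}$. If $A$ is a Conley attractor of $\mathcal{F}$ with basin $B$, then $A^{*} := \mathbb{X}\setminus B$ is a repeller of $\mathcal{F}$, and the basin of the repeller $A^{*}$ is $\mathbb{X}\setminus A$.
   Context: An iterated function system (IFS) $\mathcal{F} = (\mathbb{X}; f_1,\dots,f_N)$ on a metric space $\mathbb{X}$ is a finite collection of continuous functions $f_n : \mathbb{X}\to\mathbb{X}$, $n=1,\dots,N$. It is invertible if every $f_n$ is a homeomorphism of $\mathbb{X}$; in that case $\mathcal{F}^{*}=(\mathbb{X}; f_1^{-1},\dots,f_N^{-1})$. The same symbol denotes the map on subsets $\mathcal{F}(S) = \bigcup_{f\in\mathcal{F}} f(S)$, and $\mathcal{F}^k$ is its $k$-fold composition. A compact set $A\subset\mathbb{X}$ is a Conley attractor of $\mathcal{F}$ if there is an open set $U$ with $A\subset U$ and $A=\lim_{k\to\infty}\mathcal{F}^k(\overline{U})$ in the Hausdorff metric. The basin of $A$ is the union of all open sets $U$ with this property. The empty set is allowed as a Conley attractor (with $U=\emptyset$ and basin $\emptyset$; a sequence of sets converges to $\emptyset$ only if the sets are eventually empty). A set $R\subset\mathbb{X}$ is a repeller of the invertible IFS $\mathcal{F}$ if $R$ is a Conley attractor of $\mathcal{F}^{*}$; the basin of the repeller $R$ is its basin as a Conley attractor of $\mathcal{F}^{*}$. *)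

theory Defs
  imports "HOL-Analysis.Analysis"
begin

(* A metric space X is rendered as a type of class metric_space, so X = UNIV. *)

definition ifs :: "('a::metric_space \<Rightarrow> 'a) list \<Rightarrow> bool" where
  "ifs F \<longleftrightarrow> (\<forall>f\<in>set F. continuous_on UNIV f)"

definition invertible_ifs :: "('a::metric_space \<Rightarrow> 'a) list \<Rightarrow> bool" where
  "invertible_ifs F \<longleftrightarrow> ifs F \<and> (\<forall>f\<in>set F. \<exists>g. homeomorphism UNIV UNIV f g)"

definition inverse_ifs :: "('a::metric_space \<Rightarrow> 'a) list \<Rightarrow> ('a \<Rightarrow> 'a) list" where
  "inverse_ifs F = map inv F"

definition ifs_map :: "('a \<Rightarrow> 'a) list \<Rightarrow> 'a set \<Rightarrow> 'a set" where
  "ifs_map F S = (\<Union>f\<in>set F. f ` S)"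

(* The Hausdorff distance with values in [0,\<infinity>].  Since INF over the empty set is \<infinity>
   and SUP over it is 0, the empty set has distance 0 from itself and \<infinity> from every
   nonempty set; on nonempty compact sets this is the usual finite-valued metric. *)
definition hausdorff_dist :: "'a::metric_space set \<Rightarrow> 'a set \<Rightarrow> ennreal" where
  "hausdorff_dist S T =
     max (SUP s\<in>S. INF t\<in>T. ennreal (dist s t)) (SUP t\<in>T. INF s\<in>S. ennreal (dist s t))"

definition hausdorff_converges :: "(nat \<Rightarrow> 'a::metric_space set) \<Rightarrow> 'a set \<Rightarrow> bool" where
  "hausdorff_converges S A \<longleftrightarrow> (\<lambda>k. hausdorff_dist (S k) A) \<longlonglongrightarrow> 0"

lemma hausdorff_dist_empty_right:
  "hausdorff_dist S {} = (if S = {} then 0 else top)"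
  by (simp add: hausdorff_dist_def bot_ennreal top.extremum_unique)

lemma hausdorff_converges_empty_iff:
  "hausdorff_converges S {} \<longleftrightarrow> (\<forall>\<^sub>F k in sequentially. S k = {})"
proof
  assume "hausdorff_converges S {}"
  then have "\<forall>\<^sub>F k in sequentially. hausdorff_dist (S k) {} < 1"
    unfolding hausdorff_converges_def by (rule order_tendstoD) simp
  then show "\<forall>\<^sub>F k in sequentially. S k = {}"
    by eventually_elim (auto simp: hausdorff_dist_empty_right split: if_splits)
next
  assume "\<forall>\<^sub>F k in sequentially. S k = {}"
  then have "\<forall>\<^sub>F k in sequentially. hausdorff_dist (S k) {} = 0"
    by eventually_elim (simp add: hausdorff_dist_empty_right)
  then show "hausdorff_converges S {}"
    unfolding hausdorff_converges_def by (rule tendsto_eventually)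
qed

definition attracting_nbhd ::
    "('a::metric_space \<Rightarrow> 'a) list \<Rightarrow> 'a set \<Rightarrow> 'a set \<Rightarrow> bool" where
  "attracting_nbhd F A U \<longleftrightarrow>
     open U \<and> A \<subseteq> U \<and> hausdorff_converges (\<lambda>k. (ifs_map F ^^ k) (closure U)) A"

definition conley_attractor :: "('a::metric_space \<Rightarrow> 'a) list \<Rightarrow> 'a set \<Rightarrow> bool" where
  "conley_attractor F A \<longleftrightarrow> compact A \<and> (\<exists>U. attracting_nbhd F A U)"

definition conley_basin :: "('a::metric_space \<Rightarrow> 'a) list \<Rightarrow> 'a set \<Rightarrow> 'a set" where
  "conley_basin F A = \<Union>{U. attracting_nbhd F A U}"

definition repeller :: "('a::metric_space \<Rightarrow> 'a) list \<Rightarrow> 'a set \<Rightarrow> bool" where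
  "repeller F R \<longleftrightarrow> conley_attractor (inverse_ifs F) R"

definition repeller_basin :: "('a::metric_space \<Rightarrow> 'a) list \<Rightarrow> 'a set \<Rightarrow> 'a set" where
  "repeller_basin F R = conley_basin (inverse_ifs F) R"

end

theory Submission
  imports Defs
begin

text \<open>
  Invertibility gives the duality \<open>S \<inter> F\<^sup>*\<^sup>k(T) = \<emptyset> \<longleftrightarrow> F\<^sup>k(S) \<inter> T = \<emptyset>\<close>.
  By continuity, a point \<open>x\<close> with \<open>F\<^sup>k({x}) \<subseteq> B\<close> lies in \<open>B\<close>, so \<open>X - B \<subseteq> F\<^sup>*\<^sup>k(X - B)\<close>.
  A compact subset of the basin lies in a single attracting neighbourhood; applied to the complement
  of a neighbourhood of \<open>X - B\<close>, duality shows that every open \<open>V \<supseteq> X - B\<close> whose closure misses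
  \<open>A\<close> is attracted to \<open>X - B\<close> by \<open>F\<^sup>*\<close>. By normality these \<open>V\<close> exhaust \<open>X - A\<close>.
  Conversely, \<open>A \<subseteq> F\<^sup>k(A)\<close> keeps every attracting neighbourhood of \<open>X - B\<close> away from \<open>A\<close>.
\<close>

section \<open>Hausdorff convergence to a compact set in terms of open sets\<close>

text \<open>The right-hand side is convergence in the Vietoris topology.\<close>

lemma hausdorff_converges_iff:
  assumes "compact A"
  shows "hausdorff_converges S A \<longleftrightarrow>
    (\<forall>P. open P \<longrightarrow> A \<subseteq> P \<longrightarrow> (\<forall>\<^sub>F k in sequentially. S k \<subseteq> P)) \<and>
    (\<forall>P. open P \<longrightarrow> A \<inter> P \<noteq> {} \<longrightarrow> (\<forall>\<^sub>F k in sequentially. S k \<inter> P \<noteq> {}))"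
    (is "_ \<longleftrightarrow> ?upper \<and> ?lower")
proof (intro iffI conjI allI impI)
  fix P assume conv: "hausdorff_converges S A" and "open P" "A \<subseteq> P"
  \<comment> \<open>Compactness of \<open>A\<close> turns the open set \<open>P\<close> into one
    radius valid along all of \<open>A\<close>.\<close>
  obtain e where "e > 0" and e: "(\<Union>x\<in>A. ball x e) \<subseteq> P"
    using compact_subset_open_imp_ball_epsilon_subset[OF assms \<open>open P\<close> \<open>A \<subseteq> P\<close>] by blast
  then have "\<forall>\<^sub>F k in sequentially. hausdorff_dist (S k) A < ennreal e"
    using conv unfolding hausdorff_converges_def by (intro order_tendstoD) auto
  then show "\<forall>\<^sub>F k in sequentially. S k \<subseteq> P"
  proof eventually_elim
    case (elim k)
    show ?case
    proof
      fix s assume "s \<in> S k"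
      then have "(INF t\<in>A. ennreal (dist s t)) \<le> hausdorff_dist (S k) A"
        unfolding hausdorff_dist_def by (intro max.coboundedI1 SUP_upper)
      also note elim
      finally obtain t where "t \<in> A" "dist s t < e"
        unfolding INF_less_iff by (auto simp: ennreal_less_iff)
      then have "s \<in> (\<Union>x\<in>A. ball x e)" by (auto simp: dist_commute)
      then show "s \<in> P" using e by blast
    qed
  qed
next
  fix P assume conv: "hausdorff_converges S A" and "open P" "A \<inter> P \<noteq> {}"
  then obtain t e where t: "t \<in> A" "e > 0" "ball t e \<subseteq> P"
    by (meson disjoint_iff open_contains_ball)
  then have "\<forall>\<^sub>F k in sequentially. hausdorff_dist (S k) A < ennreal e"
    using conv unfolding hausdorff_converges_def by (intro order_tendstoD) auto
  then show "\<forall>\<^sub>F k in sequentially. S k \<inter> P \<noteq> {}"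
  proof eventually_elim
    case (elim k)
    have "(INF s\<in>S k. ennreal (dist s t)) \<le> hausdorff_dist (S k) A"
      unfolding hausdorff_dist_def using t(1) by (intro max.coboundedI2 SUP_upper)
    also note elim
    finally obtain s where "s \<in> S k" "dist s t < e"
      unfolding INF_less_iff by (auto simp: ennreal_less_iff)
    then have "s \<in> S k \<inter> ball t e" by (simp add: dist_commute)
    then show ?case using t(3) by blast
  qed
next
  assume "?upper \<and> ?lower"
  then have upper: ?upper and lower: ?lower by blast+
  have small: "\<forall>\<^sub>F k in sequentially. hausdorff_dist (S k) A \<le> ennreal e" if "e > 0" for e
  proof -
    \<comment> \<open>The lower condition handles one open set at a time, so it is applied to the
      balls around a finite \<open>e/2\<close>-net of \<open>A\<close>. A point of \<open>A\<close>
      and a point of \<open>S k\<close> in the same ball are then within \<open>e\<close>.\<close>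
    obtain C where C: "finite C" "C \<subseteq> A" "A \<subseteq> (\<Union>x\<in>C. ball x (e/2))"
    proof (rule compactE_image[OF assms, of A "\<lambda>x. ball x (e/2)"])
      show "A \<subseteq> (\<Union>x\<in>A. ball x (e/2))"
        using \<open>e > 0\<close> by (intro subsetI UN_I) auto
    qed auto
    have "\<forall>\<^sub>F k in sequentially. S k \<subseteq> (\<Union>x\<in>A. ball x e)"
    proof -
      have "A \<subseteq> (\<Union>x\<in>A. ball x e)"
        using \<open>e > 0\<close> by (intro subsetI UN_I) auto
      then show ?thesis using upper by (simp add: open_UN)
    qed
    moreover have "\<forall>\<^sub>F k in sequentially. \<forall>x\<in>C. S k \<inter> ball x (e/2) \<noteq> {}"
    proof (intro eventually_ball_finite ballI C(1))
      fix x assume "x \<in> C"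
      then have "A \<inter> ball x (e/2) \<noteq> {}"
        using C(2) \<open>e > 0\<close> by (metis IntI centre_in_ball empty_iff half_gt_zero subsetD)
      then show "\<forall>\<^sub>F k in sequentially. S k \<inter> ball x (e/2) \<noteq> {}"
        using lower by blast
    qed
    ultimately show ?thesis
    proof eventually_elim
      case (elim k)
      show ?case
        unfolding hausdorff_dist_def
      proof (intro max.boundedI SUP_least)
        fix s assume "s \<in> S k"
        then have "s \<in> (\<Union>t\<in>A. ball t e)" using elim(1) by blast
        then obtain t where "t \<in> A" "dist s t < e"
          by (auto simp: dist_commute)
        then show "(INF t\<in>A. ennreal (dist s t)) \<le> ennreal e"
          by (intro INF_lower2[of t] ennreal_leI) auto
      next
        fix t assume "t \<in> A"
        then obtain x where x: "x \<in> C" "dist x t < e/2"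
          using C(3) by auto
        then have "S k \<inter> ball x (e/2) \<noteq> {}" using elim(2) by blast
        then obtain s where s: "s \<in> S k" "dist x s < e/2"
          by auto
        have "dist s t \<le> e"
          using dist_triangle_half_r[OF s(2) x(2)] by simp
        then show "(INF s\<in>S k. ennreal (dist s t)) \<le> ennreal e"
          using s by (intro INF_lower2[of s] ennreal_leI) auto
      qed
    qed
  qed
  show "hausdorff_converges S A"
    unfolding hausdorff_converges_def
  proof (rule order_tendstoI)
    fix a :: ennreal assume "0 < a"
    \<comment> \<open>The bound \<open>a\<close> may be infinite. An intermediate \<open>c\<close>
      is finite, hence comes from a real radius.\<close>
    then obtain c where c: "0 < c" "c < a" using dense by blast
    then obtain e where "c = ennreal e" "e > 0"
      by (cases c) (auto simp: ennreal_less_zero_iff)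
    then have "\<forall>\<^sub>F k in sequentially. hausdorff_dist (S k) A \<le> c"
      using small by simp
    then show "\<forall>\<^sub>F k in sequentially. hausdorff_dist (S k) A < a"
      by eventually_elim (use c in order)
  qed auto
qed

lemma attracting_nbhd_iff:
  assumes "compact A"
  shows "attracting_nbhd F A U \<longleftrightarrow> open U \<and> A \<subseteq> U \<and>
    (\<forall>P. open P \<longrightarrow> A \<subseteq> P \<longrightarrow> (\<forall>\<^sub>F k in sequentially. (ifs_map F ^^ k) (closure U) \<subseteq> P)) \<and>
    (\<forall>P. open P \<longrightarrow> A \<inter> P \<noteq> {} \<longrightarrow>
      (\<forall>\<^sub>F k in sequentially. (ifs_map F ^^ k) (closure U) \<inter> P \<noteq> {}))"
  unfolding attracting_nbhd_def hausdorff_converges_iff[OF assms] by blast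

section \<open>Iterates of the set map\<close>

lemma ifs_map_Un: "ifs_map F (S \<union> T) = ifs_map F S \<union> ifs_map F T"
  by (auto simp: ifs_map_def)

lemma ifs_map_funpow_Un:
  "(ifs_map F ^^ k) (S \<union> T) = (ifs_map F ^^ k) S \<union> (ifs_map F ^^ k) T"
  by (induction k) (simp_all add: ifs_map_Un)

lemma ifs_map_funpow_mono: "S \<subseteq> T \<Longrightarrow> (ifs_map F ^^ k) S \<subseteq> (ifs_map F ^^ k) T"
  by (metis ifs_map_funpow_Un subset_Un_eq)

lemma compact_ifs_map: "ifs F \<Longrightarrow> compact S \<Longrightarrow> compact (ifs_map F S)"
  unfolding ifs_map_def ifs_def
  by (intro compact_UN ballI compact_continuous_image) (auto intro: continuous_on_subset)

text \<open>This is continuity of the iterated set map: \<open>Q\<close> consists of the points all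
  of whose \<open>k\<close>-step images lie in \<open>P\<close>. One step is a finite intersection
  of open preimages, and induction does the rest.\<close>

lemma ifs_map_funpow_preimage:
  assumes "ifs F" "open P"
  obtains Q where "open Q" "\<And>S. (ifs_map F ^^ k) S \<subseteq> P \<longleftrightarrow> S \<subseteq> Q"
proof -
  have "\<exists>Q. open Q \<and> (\<forall>S. (ifs_map F ^^ k) S \<subseteq> P \<longleftrightarrow> S \<subseteq> Q)"
    using assms(2)
  proof (induction k arbitrary: P)
    case (Suc k)
    have "open (\<Inter>f\<in>set F. f -` P)"
      using assms(1) Suc.prems by (auto simp: ifs_def intro!: open_INT open_vimage)
    moreover have "ifs_map F S \<subseteq> P \<longleftrightarrow> S \<subseteq> (\<Inter>f\<in>set F. f -` P)" for S
      by (auto simp: ifs_map_def)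
    ultimately show ?case
      using Suc.IH by auto
  qed auto
  then show thesis using that by blast
qed

section \<open>Duality between an invertible system and its inverse\<close>

lemma invertible_ifs_bij: "invertible_ifs F \<Longrightarrow> f \<in> set F \<Longrightarrow> bij f"
  unfolding invertible_ifs_def homeomorphism_def
  by (metis UNIV_I bijI')

text \<open>For a bijection \<open>f\<close>, a point \<open>x\<close> lies in the image of
  \<open>T\<close> under \<open>inv f\<close> exactly when \<open>f x\<close> lies in
  \<open>T\<close>.\<close>

lemma ifs_map_inverse_disjoint_iff:
  assumes "invertible_ifs F"
  shows "S \<inter> ifs_map (inverse_ifs F) T = {} \<longleftrightarrow> ifs_map F S \<inter> T = {}"
proof -
  have "inv f ` T = f -` T" if "f \<in> set F" for f
    using invertible_ifs_bij[OF assms that] by (simp add: bij_vimage_eq_inv_image)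
  then show ?thesis
    by (fastforce simp: ifs_map_def inverse_ifs_def)
qed

lemma ifs_map_inverse_funpow_disjoint_iff:
  assumes "invertible_ifs F"
  shows "S \<inter> (ifs_map (inverse_ifs F) ^^ k) T = {} \<longleftrightarrow> (ifs_map F ^^ k) S \<inter> T = {}"
proof (induction k arbitrary: T)
  case (Suc k)
  have "S \<inter> (ifs_map (inverse_ifs F) ^^ Suc k) T = {} \<longleftrightarrow>
      S \<inter> (ifs_map (inverse_ifs F) ^^ k) (ifs_map (inverse_ifs F) T) = {}"
    by (simp add: funpow_swap1)
  also have "\<dots> \<longleftrightarrow> ifs_map F ((ifs_map F ^^ k) S) \<inter> T = {}"
    by (simp only: Suc ifs_map_inverse_disjoint_iff[OF assms])
  finally show ?case by simp
qed simp

section \<open>Attracting neighbourhoods and the basin\<close>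

text \<open>Only the upper half of convergence is required of \<open>W\<close>: enlarging a set
  cannot spoil the lower half, which is inherited from \<open>U\<close>.\<close>

lemma attracting_nbhd_Un:
  assumes "compact A" "attracting_nbhd F A U" "open W"
    and "\<And>P. open P \<Longrightarrow> A \<subseteq> P \<Longrightarrow>
      \<forall>\<^sub>F k in sequentially. (ifs_map F ^^ k) (closure W) \<subseteq> P"
  shows "attracting_nbhd F A (U \<union> W)"
  unfolding attracting_nbhd_iff[OF assms(1)]
proof (intro conjI allI impI)
  note U = assms(2)[unfolded attracting_nbhd_iff[OF assms(1)]]
  show "open (U \<union> W)" "A \<subseteq> U \<union> W"
    using U assms(3) by auto
  fix P :: "'a set" assume "open P"
  {
    assume "A \<subseteq> P"
    then have "\<forall>\<^sub>F k in sequentially. (ifs_map F ^^ k) (closure U) \<subseteq> P"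
      "\<forall>\<^sub>F k in sequentially. (ifs_map F ^^ k) (closure W) \<subseteq> P"
      using U assms(4) \<open>open P\<close> by blast+
    then show "\<forall>\<^sub>F k in sequentially. (ifs_map F ^^ k) (closure (U \<union> W)) \<subseteq> P"
      by eventually_elim (simp add: closure_Un ifs_map_funpow_Un)
  }
  {
    assume "A \<inter> P \<noteq> {}"
    then have "\<forall>\<^sub>F k in sequentially. (ifs_map F ^^ k) (closure U) \<inter> P \<noteq> {}"
      using U \<open>open P\<close> by blast
    then show "\<forall>\<^sub>F k in sequentially. (ifs_map F ^^ k) (closure (U \<union> W)) \<inter> P \<noteq> {}"
      by eventually_elim (auto simp: closure_Un ifs_map_funpow_Un)
  }
qed

text \<open>The separate \<open>U\<close> covers the case of empty \<open>\<D>\<close>, since the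
  empty set attracts to \<open>A\<close> only when \<open>A\<close> is empty.\<close>

lemma attracting_nbhd_Union:
  assumes "compact A" "attracting_nbhd F A U" "finite \<D>"
    and "\<And>W. W \<in> \<D> \<Longrightarrow> attracting_nbhd F A W"
  shows "attracting_nbhd F A (U \<union> \<Union>\<D>)"
  using assms(3,4)
proof (induction \<D>)
  case (insert W \<D>)
  then have U: "attracting_nbhd F A (U \<union> \<Union>\<D>)" and W: "attracting_nbhd F A W"
    by auto
  note W' = W[unfolded attracting_nbhd_iff[OF assms(1)]]
  have "attracting_nbhd F A ((U \<union> \<Union>\<D>) \<union> W)"
    by (rule attracting_nbhd_Un[OF assms(1) U]) (use W' in simp_all)
  then show ?case by (simp add: Un_ac)
qed (use assms(2) in simp)

lemma open_conley_basin: "open (conley_basin F A)"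
  by (auto simp: conley_basin_def attracting_nbhd_def)

lemma compact_subset_conley_basin:
  assumes "conley_attractor F A" "compact K" "K \<subseteq> conley_basin F A"
  obtains U where "attracting_nbhd F A U" "K \<subseteq> U"
proof -
  obtain U where A: "compact A" and U: "attracting_nbhd F A U"
    using assms(1) by (auto simp: conley_attractor_def)
  obtain \<D> where \<D>: "\<D> \<subseteq> Collect (attracting_nbhd F A)" "finite \<D>" "K \<subseteq> \<Union>\<D>"
    using compactE[OF assms(2) assms(3)[unfolded conley_basin_def]]
    by (metis attracting_nbhd_def mem_Collect_eq)
  then show thesis
    using that[of "U \<union> \<Union>\<D>"] attracting_nbhd_Union[OF A U] by blast
qed

text \<open>The finite set of \<open>m\<close>-step images of \<open>x\<close> lies in a single
  attracting neighbourhood \<open>U\<close>. By continuity a whole closed ball around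
  \<open>x\<close> enters \<open>U\<close> after \<open>m\<close> steps, so a ball around
  \<open>x\<close> can be added to \<open>U\<close>.\<close>

lemma attracted_in_conley_basin:
  assumes "ifs F" "conley_attractor F A" "finite ((ifs_map F ^^ m) {x})"
    and "(ifs_map F ^^ m) {x} \<subseteq> conley_basin F A"
  shows "x \<in> conley_basin F A"
proof -
  have A: "compact A"
    using assms(2) by (simp add: conley_attractor_def)
  obtain U where U: "attracting_nbhd F A U" "(ifs_map F ^^ m) {x} \<subseteq> U"
    using compact_subset_conley_basin[OF assms(2) finite_imp_compact[OF assms(3)] assms(4)] .
  have "open U" using U by (simp add: attracting_nbhd_def)
  obtain Q where Q: "open Q" "\<And>S. (ifs_map F ^^ m) S \<subseteq> U \<longleftrightarrow> S \<subseteq> Q"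
    using ifs_map_funpow_preimage[OF assms(1) \<open>open U\<close>] by metis
  then obtain e where "e > 0" "cball x e \<subseteq> Q"
    using U(2) by (auto simp: open_contains_cball)
  then have "closure (ball x e) \<subseteq> Q"
    by (meson ball_subset_cball closed_cball closure_minimal order_trans)
  then have m: "(ifs_map F ^^ m) (closure (ball x e)) \<subseteq> closure U"
    using Q(2) closure_subset by (meson order_trans)
  have "attracting_nbhd F A (U \<union> ball x e)"
  proof (rule attracting_nbhd_Un[OF A U(1) open_ball])
    fix P assume "open P" "A \<subseteq> P"
    then have "\<forall>\<^sub>F k in sequentially. (ifs_map F ^^ k) (closure U) \<subseteq> P"
      using U(1) unfolding attracting_nbhd_iff[OF A] by blast
    \<comment> \<open>After \<open>m\<close> steps the ball follows \<open>closure U\<close>. The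
      delay \<open>m\<close> does not affect eventual containment.\<close>
    then have "\<forall>\<^sub>F k in sequentially. (ifs_map F ^^ (k + m)) (closure (ball x e)) \<subseteq> P"
    proof eventually_elim
      case (elim k)
      then show ?case
        using ifs_map_funpow_mono[OF m, of k F] by (simp add: funpow_add)
    qed
    then show "\<forall>\<^sub>F k in sequentially. (ifs_map F ^^ k) (closure (ball x e)) \<subseteq> P"
      by (rule eventually_sequentially_seg[THEN iffD1])
  qed
  then show ?thesis
    using \<open>e > 0\<close> unfolding conley_basin_def by force
qed

lemma finite_ifs_map_funpow: "finite S \<Longrightarrow> finite ((ifs_map F ^^ k) S)"
  by (induction k) (auto simp: ifs_map_def)

section \<open>Normality, and covering of the attractor by its own images\<close>

lemma closed_disjoint_open_closure:
  fixes S T :: "'a::metric_space set"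
  assumes "closed S" "closed T" "S \<inter> T = {}"
  obtains V where "open V" "S \<subseteq> V" "closure V \<inter> T = {}"
proof -
  obtain V W where VW: "open V" "open W" "S \<subseteq> V" "T \<subseteq> W" "V \<inter> W = {}"
    using t4_space[OF assms] by blast
  then have "closure V \<inter> W = {}"
    by (metis Int_commute open_Int_closure_eq_empty)
  with VW that show thesis by blast
qed

text \<open>Iterates of \<open>closure U\<close> eventually enter any neighbourhood of
  \<open>A\<close>, so their images stay near \<open>ifs_map F A\<close>. They must also come close
  to each point of \<open>A\<close>, so no such point can be at positive distance from the compact
  set \<open>ifs_map F A\<close>.\<close>

lemma conley_attractor_subset_ifs_map:
  assumes "ifs F" "conley_attractor F A"
  shows "A \<subseteq> ifs_map F A"
proof
  fix x assume "x \<in> A"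
  obtain U where A: "compact A" and "attracting_nbhd F A U"
    using assms(2) by (auto simp: conley_attractor_def)
  note U = this(2)[unfolded attracting_nbhd_iff[OF A]]
  show "x \<in> ifs_map F A"
  proof (rule ccontr)
    assume "x \<notin> ifs_map F A"
    moreover have "closed (ifs_map F A)"
      using compact_ifs_map[OF assms(1) A] by (rule compact_imp_closed)
    ultimately obtain V where V: "open V" "ifs_map F A \<subseteq> V" "closure V \<inter> {x} = {}"
      using closed_disjoint_open_closure[of _ "{x}"] by auto
    obtain Q where Q: "open Q" "\<And>S. ifs_map F S \<subseteq> V \<longleftrightarrow> S \<subseteq> Q"
      using ifs_map_funpow_preimage[OF assms(1) V(1), of 1] by auto
    have "\<forall>\<^sub>F k in sequentially. (ifs_map F ^^ k) (closure U) \<subseteq> Q"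
    proof -
      have "A \<subseteq> Q" using Q(2) V(2) by simp
      then show ?thesis using U Q(1) by simp
    qed
    moreover have "\<forall>\<^sub>F k in sequentially. (ifs_map F ^^ k) (closure U) \<inter> - closure V \<noteq> {}"
    proof -
      have "open (- closure V)" "A \<inter> - closure V \<noteq> {}"
        using V(3) \<open>x \<in> A\<close> by auto
      then show ?thesis using U by simp
    qed
    \<comment> \<open>The shift by one compares the image of the \<open>k\<close>-th iterate, which
      lies in \<open>V\<close> once that iterate is in \<open>Q\<close>, with the points outside
      \<open>closure V\<close> that it must contain.\<close>
    then have "\<forall>\<^sub>F k in sequentially. (ifs_map F ^^ Suc k) (closure U) \<inter> - closure V \<noteq> {}"
      by (rule eventually_sequentially_Suc[THEN iffD2])
    ultimately have "\<forall>\<^sub>F k in sequentially. False"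
    proof eventually_elim
      case (elim k)
      then have "(ifs_map F ^^ Suc k) (closure U) \<subseteq> V" using Q(2) by simp
      with elim(2) show ?case using closure_subset[of V] by blast
    qed
    then show False by simp
  qed
qed

lemma conley_attractor_subset_ifs_map_funpow:
  assumes "ifs F" "conley_attractor F A"
  shows "A \<subseteq> (ifs_map F ^^ k) A"
proof (induction k)
  case (Suc k)
  have "A \<subseteq> ifs_map F A" by (rule conley_attractor_subset_ifs_map[OF assms])
  also have "\<dots> \<subseteq> (ifs_map F ^^ Suc k) A"
    using ifs_map_funpow_mono[OF Suc, of 1 F] by simp
  finally show ?case .
qed simp

section \<open>The complement of the basin as a repeller\<close>

context
  fixes F :: "('a::metric_space \<Rightarrow> 'a) list" and A :: "'a set"
  assumes compact_space: "compact (UNIV :: 'a set)"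
    and inv: "invertible_ifs F"
    and attractor: "conley_attractor F A"
begin

lemma compact_attractor: "compact A"
  using attractor by (simp add: conley_attractor_def)

lemma compact_Compl_basin: "compact (- conley_basin F A)"
  using compact_Int_closed[OF compact_space] open_conley_basin[of F A]
  by (metis Int_UNIV_left closed_Compl)

lemma attractor_subset_basin: "A \<subseteq> conley_basin F A"
  using attractor by (auto simp: conley_attractor_def conley_basin_def attracting_nbhd_def)

text \<open>By duality a point \<open>x\<close> missing from the right-hand side has all its
  \<open>k\<close>-step images under \<open>F\<close> in the basin, which forces \<open>x\<close>
  into the basin.\<close>

lemma Compl_basin_subset_inverse_funpow:
  "- conley_basin F A \<subseteq> (ifs_map (inverse_ifs F) ^^ k) (- conley_basin F A)"
proof (rule subsetI, rule ccontr)
  fix x assume x: "x \<in> - conley_basin F A"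
    and "x \<notin> (ifs_map (inverse_ifs F) ^^ k) (- conley_basin F A)"
  then have "{x} \<inter> (ifs_map (inverse_ifs F) ^^ k) (- conley_basin F A) = {}"
    by blast
  then have "(ifs_map F ^^ k) {x} \<subseteq> conley_basin F A"
    unfolding ifs_map_inverse_funpow_disjoint_iff[OF inv] by blast
  then have "x \<in> conley_basin F A"
    using attracted_in_conley_basin[OF _ attractor] inv
    by (simp add: invertible_ifs_def finite_ifs_map_funpow)
  with x show False by simp
qed

text \<open>For the upper half, \<open>- P\<close> is a compact part of the basin, so its forward
  iterates eventually avoid \<open>closure V\<close>; duality moves this to the inverse system. The
  lower half holds for every \<open>k\<close>, because each inverse iterate of
  \<open>closure V\<close> contains \<open>- conley_basin F A\<close>.\<close>

lemma attracting_nbhd_Compl_basinI: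
  assumes "open V" "- conley_basin F A \<subseteq> V" "closure V \<inter> A = {}"
  shows "attracting_nbhd (inverse_ifs F) (- conley_basin F A) V"
  unfolding attracting_nbhd_iff[OF compact_Compl_basin]
proof (intro conjI allI impI)
  fix P :: "'a set" assume "open P" "- conley_basin F A \<subseteq> P"
  then have "compact (- P)" "- P \<subseteq> conley_basin F A"
    using compact_Int_closed[OF compact_space, of "- P"] by auto
  then obtain U where U: "attracting_nbhd F A U" "- P \<subseteq> U"
    using compact_subset_conley_basin[OF attractor] by metis
  then have "\<forall>\<^sub>F k in sequentially. (ifs_map F ^^ k) (closure U) \<subseteq> - closure V"
  proof -
    have "open (- closure V)" "A \<subseteq> - closure V"
      using assms(3) by auto
    then show ?thesis
      using U(1) unfolding attracting_nbhd_iff[OF compact_attractor] by simp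
  qed
  then show "\<forall>\<^sub>F k in sequentially. (ifs_map (inverse_ifs F) ^^ k) (closure V) \<subseteq> P"
  proof eventually_elim
    case (elim k)
    have "(ifs_map F ^^ k) (- P) \<subseteq> (ifs_map F ^^ k) (closure U)"
      using U(2) closure_subset by (intro ifs_map_funpow_mono) blast
    with elim have "(ifs_map F ^^ k) (- P) \<inter> closure V = {}" by blast
    then have "- P \<inter> (ifs_map (inverse_ifs F) ^^ k) (closure V) = {}"
      by (simp add: ifs_map_inverse_funpow_disjoint_iff[OF inv])
    then show ?case by blast
  qed
next
  fix P :: "'a set" assume P: "- conley_basin F A \<inter> P \<noteq> {}"
  have "- conley_basin F A \<subseteq> (ifs_map (inverse_ifs F) ^^ k) (closure V)" for k
  proof -
    have "- conley_basin F A \<subseteq> closure V"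
      using assms(2) closure_subset by (rule order_trans)
    from ifs_map_funpow_mono[OF this] show ?thesis
      using Compl_basin_subset_inverse_funpow by (rule order_trans[rotated])
  qed
  with P show "\<forall>\<^sub>F k in sequentially. (ifs_map (inverse_ifs F) ^^ k) (closure V) \<inter> P \<noteq> {}"
    by (intro always_eventually) blast
qed (use assms in auto)

text \<open>Some inverse iterate of \<open>closure V\<close> lies in the open set
  \<open>- A\<close>. By duality \<open>closure V\<close> misses a forward iterate of
  \<open>A\<close>, and that iterate contains \<open>A\<close>.\<close>

lemma attracting_nbhd_Compl_basin_disjoint:
  assumes "attracting_nbhd (inverse_ifs F) (- conley_basin F A) V"
  shows "V \<inter> A = {}"
proof -
  have "\<forall>\<^sub>F k in sequentially. (ifs_map (inverse_ifs F) ^^ k) (closure V) \<subseteq> - A"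
  proof -
    have "open (- A)" "- conley_basin F A \<subseteq> - A"
      using attractor_subset_basin compact_imp_closed[OF compact_attractor] by auto
    then show ?thesis
      using assms unfolding attracting_nbhd_iff[OF compact_Compl_basin] by simp
  qed
  then obtain k where "(ifs_map (inverse_ifs F) ^^ k) (closure V) \<subseteq> - A"
    by (auto simp: eventually_sequentially)
  then have "(ifs_map F ^^ k) A \<inter> closure V = {}"
    unfolding ifs_map_inverse_funpow_disjoint_iff[OF inv, symmetric] by blast
  moreover have "A \<subseteq> (ifs_map F ^^ k) A"
    using conley_attractor_subset_ifs_map_funpow attractor inv
    by (auto simp: invertible_ifs_def)
  ultimately show ?thesis
    using closure_subset by blast
qed

text \<open>The empty \<open>S\<close> yields the existence of an attracting neighbourhood, and
  singletons \<open>S\<close> place the points outside \<open>A\<close> in the basin of the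
  repeller.\<close>

lemma attracting_nbhd_Compl_basin_ex:
  assumes "closed S" "S \<inter> A = {}"
  obtains V where "attracting_nbhd (inverse_ifs F) (- conley_basin F A) V" "S \<subseteq> V"
proof -
  have "closed (- conley_basin F A \<union> S)" "closed A" "(- conley_basin F A \<union> S) \<inter> A = {}"
    using assms attractor_subset_basin compact_attractor compact_Compl_basin
    by (auto intro: compact_imp_closed)
  then obtain V where "open V" "- conley_basin F A \<union> S \<subseteq> V" "closure V \<inter> A = {}"
    by (rule closed_disjoint_open_closure)
  then show thesis
    using attracting_nbhd_Compl_basinI that by (metis le_sup_iff)
qed

lemma repeller_Compl_basin: "repeller F (- conley_basin F A)"
  unfolding repeller_def conley_attractor_def
  using compact_Compl_basin attracting_nbhd_Compl_basin_ex[of "{}"] by auto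

lemma repeller_basin_Compl_basin: "repeller_basin F (- conley_basin F A) = - A"
proof
  show "repeller_basin F (- conley_basin F A) \<subseteq> - A"
    using attracting_nbhd_Compl_basin_disjoint
    by (auto simp: repeller_basin_def conley_basin_def[of "inverse_ifs F"])
  show "- A \<subseteq> repeller_basin F (- conley_basin F A)"
  proof
    fix x assume "x \<in> - A"
    then obtain V where "attracting_nbhd (inverse_ifs F) (- conley_basin F A) V" "{x} \<subseteq> V"
      using attracting_nbhd_Compl_basin_ex[of "{x}"] by auto
    then show "x \<in> repeller_basin F (- conley_basin F A)"
      by (auto simp: repeller_basin_def conley_basin_def[of "inverse_ifs F"])
  qed
qed

end

theorem theorem5p2:
  fixes F :: "('a::metric_space \<Rightarrow> 'a) list" and A B :: "'a set"
  assumes "compact (UNIV :: 'a set)"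
    and "invertible_ifs F"
    and "conley_attractor F A"
    and "B = conley_basin F A"
  shows "repeller F (UNIV - B) \<and> repeller_basin F (UNIV - B) = UNIV - A"
  using repeller_Compl_basin[OF assms(1-3)] repeller_basin_Compl_basin[OF assms(1-3)] assms(4)
  by (simp add: Compl_eq_Diff_UNIV)

end
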